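(* The pair $\left(-\frac15,\frac57\right)$ is an odd rational cycle of period 2 of the function $Q:\mathbb{Z}_2\to\mathbb{Z}_2$; that is, $Q\left(-\frac15\right)=\frac57$ and $Q\left(\frac57\right)=-\frac15$.
   Context: The $3x+1$ map $T:\mathbb{Z}_2\to\mathbb{Z}_2$ on the 2-adic integers is $T(x)=\frac{3x+1}{2}$ if $x$ is odd, $T(x)=\frac x2$ if $x$ is even. For $x\in\mathbb{Z}_2$, the parity sequence of $x$ is $(s_0,s_1,s_2,\ldots)$ with $s_k\in\{0,1\}$, $s_k\equiv T^k(x)\pmod 2$, and $Q(x)=\sum_{k=0}^\infty s_k2^k\in\mathbb{Z}_2$. Rational numbers with odd denominator are regarded as elements of $\mathbb{Z}_2$. *)

theory Defs
  imports Complex_Main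
begin

section \<open>The ring of 2-adic integers\<close>

text \<open>The inverse limit of the rings of integers modulo \<open>2 ^ n\<close>; the \<open>n\<close>-th component is the
  representative in \<open>{0..<2 ^ n}\<close> (the range is forced by the coherence condition).\<close>

typedef two_adic = "{a :: nat \<Rightarrow> int. \<forall>n. a (Suc n) mod 2 ^ n = a n}"
  morphisms residue Abs_two_adic
  by (rule exI[of _ "\<lambda>n. 0"]) simp

setup_lifting type_definition_two_adic

lemma residue_Suc_mod: "residue x (Suc n) mod 2 ^ n = residue x n"
  using residue[of x] by simp

lemma residue_mod_self [simp]: "residue x n mod 2 ^ n = residue x n"
  by (metis residue_Suc_mod mod_mod_trivial)

lemma residue_0 [simp]: "residue x 0 = 0"
  using residue_mod_self[of x 0] by simp

lemma two_adic_eqI: "(\<And>n. residue x n = residue y n) \<Longrightarrow> x = y"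
  by (simp add: residue_inject[symmetric] fun_eq_iff)

lemma mod_power2_Suc: "a mod 2 ^ Suc n mod 2 ^ n = (a :: int) mod 2 ^ n"
  by (simp add: mod_mod_cancel le_imp_power_dvd)

lemma residue_mod_le: "m \<le> n \<Longrightarrow> residue x n mod 2 ^ m = residue x m"
proof (induction n rule: dec_induct)
  case (step n)
  have "residue x (Suc n) mod 2 ^ m = residue x (Suc n) mod 2 ^ n mod 2 ^ m"
    using step.hyps by (simp add: mod_mod_cancel le_imp_power_dvd del: residue_mod_self)
  then show ?case using step.IH by (simp add: residue_Suc_mod)
qed simp

instantiation two_adic :: comm_ring_1
begin

lift_definition zero_two_adic :: two_adic is "\<lambda>n. 0" by simp

lift_definition one_two_adic :: two_adic is "\<lambda>n. 1 mod 2 ^ n"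
  by (simp only: mod_power2_Suc simp_thms)

lift_definition plus_two_adic :: "two_adic \<Rightarrow> two_adic \<Rightarrow> two_adic"
  is "\<lambda>a b n. (a n + b n) mod 2 ^ n"
  by (metis mod_add_eq mod_power2_Suc)

lift_definition times_two_adic :: "two_adic \<Rightarrow> two_adic \<Rightarrow> two_adic"
  is "\<lambda>a b n. (a n * b n) mod 2 ^ n"
  by (metis mod_mult_eq mod_power2_Suc)

lift_definition minus_two_adic :: "two_adic \<Rightarrow> two_adic \<Rightarrow> two_adic"
  is "\<lambda>a b n. (a n - b n) mod 2 ^ n"
  by (metis mod_diff_eq mod_power2_Suc)

lift_definition uminus_two_adic :: "two_adic \<Rightarrow> two_adic"
  is "\<lambda>a n. (- a n) mod 2 ^ n"
  by (metis mod_minus_eq mod_power2_Suc)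

instance
proof
  fix a b c :: two_adic
  show "a * b * c = a * (b * c)"
    by (rule two_adic_eqI) (simp add: times_two_adic.rep_eq mod_simps mult.assoc)
  show "a * b = b * a"
    by (rule two_adic_eqI) (simp add: times_two_adic.rep_eq mult.commute)
  show "1 * a = a"
    by (rule two_adic_eqI) (simp add: times_two_adic.rep_eq one_two_adic.rep_eq mod_simps)
  show "a + b + c = a + (b + c)"
    by (rule two_adic_eqI) (simp add: plus_two_adic.rep_eq mod_simps add.assoc)
  show "a + b = b + a"
    by (rule two_adic_eqI) (simp add: plus_two_adic.rep_eq add.commute)
  show "0 + a = a"
    by (rule two_adic_eqI) (simp add: plus_two_adic.rep_eq zero_two_adic.rep_eq)
  show "- a + a = 0"
    by (rule two_adic_eqI)
       (simp add: plus_two_adic.rep_eq zero_two_adic.rep_eq uminus_two_adic.rep_eq mod_simps)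
  show "a - b = a + - b"
    by (rule two_adic_eqI)
       (simp add: plus_two_adic.rep_eq minus_two_adic.rep_eq uminus_two_adic.rep_eq mod_simps)
  show "(a + b) * c = a * c + b * c"
    by (rule two_adic_eqI)
       (simp add: plus_two_adic.rep_eq times_two_adic.rep_eq mod_simps distrib_right)
  show "(0 :: two_adic) \<noteq> 1"
  proof
    assume "(0 :: two_adic) = 1"
    then have "residue 0 1 = residue 1 1" by simp
    then show False by (simp add: zero_two_adic.rep_eq one_two_adic.rep_eq)
  qed
qed

end

lemma residue_of_nat: "residue (of_nat k) n = int k mod 2 ^ n"
  by (induction k)
     (simp_all add: zero_two_adic.rep_eq one_two_adic.rep_eq plus_two_adic.rep_eq mod_simps)

lemma residue_of_int: "residue (of_int k) n = k mod 2 ^ n"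
  by (cases k rule: int_diff_cases)
     (simp add: minus_two_adic.rep_eq residue_of_nat mod_simps)

lemma residue_numeral: "residue (numeral k) n = numeral k mod 2 ^ n"
  using residue_of_int[of "numeral k" n] by simp


section \<open>The 2-adic metric\<close>

text \<open>For \<open>x \<noteq> y\<close> the exponent below is the 2-adic valuation of \<open>x - y\<close>: the largest \<open>n\<close>
  such that \<open>x\<close> and \<open>y\<close> agree modulo \<open>2 ^ n\<close>.\<close>

instantiation two_adic :: metric_space
begin

definition dist_two_adic :: "two_adic \<Rightarrow> two_adic \<Rightarrow> real" where
  "dist x y = (if x = y then 0
     else (1 / 2) ^ (LEAST n. residue x (Suc n) \<noteq> residue y (Suc n)))"

definition uniformity_two_adic :: "(two_adic \<times> two_adic) filter" where
  "uniformity_two_adic = (INF e\<in>{0<..}. principal {(x, y). dist x y < e})"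

definition open_two_adic :: "two_adic set \<Rightarrow> bool" where
  "open_two_adic U \<longleftrightarrow> (\<forall>x\<in>U. eventually (\<lambda>(x', y). x' = x \<longrightarrow> y \<in> U) uniformity)"

lemma dist_two_adic_le_iff:
  "dist x y \<le> (1 / 2) ^ n \<longleftrightarrow> residue x n = residue (y :: two_adic) n"
proof (cases "x = y")
  case False
  define L where "L = (LEAST n. residue x (Suc n) \<noteq> residue y (Suc n))"
  obtain m where "residue x m \<noteq> residue y m" using False two_adic_eqI by blast
  then obtain m' where "residue x (Suc m') \<noteq> residue y (Suc m')"
    by (cases m) auto
  then have L: "residue x (Suc L) \<noteq> residue y (Suc L)"
    unfolding L_def by (rule LeastI)
  have below: "residue x k = residue y k" if "k \<le> L" for k
    using that not_less_Least[of "k - 1" "\<lambda>n. residue x (Suc n) \<noteq> residue y (Suc n)"]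
    unfolding L_def[symmetric] by (cases k) auto
  have "residue x n = residue y n \<longleftrightarrow> n \<le> L"
    using below L residue_mod_le[of "Suc L" n] by (metis not_less_eq_eq)
  moreover have "(1 / 2 :: real) ^ L \<le> (1 / 2) ^ n \<longleftrightarrow> n \<le> L"
    by (rule power_decreasing_iff) auto
  ultimately show ?thesis
    using False by (simp add: dist_two_adic_def L_def)
qed (simp add: dist_two_adic_def)

instance
proof
  fix x y z :: two_adic
  show "dist x y = 0 \<longleftrightarrow> x = y" by (simp add: dist_two_adic_def)
  have pow: "\<exists>n. dist u v = (1 / 2) ^ n" if "u \<noteq> v" for u v :: two_adic
    using that by (auto simp: dist_two_adic_def)
  have ge0: "dist u v \<ge> 0" for u v :: two_adic by (simp add: dist_two_adic_def)
  have "dist x y \<le> max (dist x z) (dist y z)"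
  proof (cases "x = z \<or> y = z")
    case True
    have "dist x y = dist y x" by (simp add: dist_two_adic_def eq_commute)
    with True show ?thesis by auto
  next
    case False
    then obtain m n where mn: "dist x z = (1 / 2) ^ m" "dist y z = (1 / 2) ^ n"
      using pow by meson
    define k where "k = min m n"
    have "(1 / 2 :: real) ^ m \<le> (1 / 2) ^ k" "(1 / 2 :: real) ^ n \<le> (1 / 2) ^ k"
      by (auto simp: k_def intro!: power_decreasing)
    then have "dist x y \<le> (1 / 2) ^ k"
      using mn by (metis dist_two_adic_le_iff)
    moreover have "(1 / 2 :: real) ^ k \<le> max ((1 / 2) ^ m) ((1 / 2) ^ n)"
      by (simp add: k_def min_def)
    ultimately show ?thesis using mn by simp
  qed
  then show "dist x y \<le> dist x z + dist y z" using ge0[of x z] ge0[of y z] by linarith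
qed (rule uniformity_two_adic_def open_two_adic_def)+

end


section \<open>Rationals with odd denominator as 2-adic integers\<close>

text \<open>Meaningful for odd denominators only, see \<open>two_adic_of_rat_unique\<close>.\<close>

definition two_adic_of_rat :: "rat \<Rightarrow> two_adic" where
  "two_adic_of_rat r =
     (THE y. of_int (snd (quotient_of r)) * y = of_int (fst (quotient_of r)))"

lemma ex1_odd_quotient:
  assumes "odd q"
  shows "\<exists>!y :: two_adic. of_int q * y = z"
proof -
  have cop: "coprime q (2 ^ n)" for n using assms by simp
  have "\<exists>i. \<forall>n. (q * i n) mod 2 ^ n = 1 mod 2 ^ n"
  proof (rule choice, rule allI)
    fix n
    obtain u v where "u * q + v * 2 ^ n = 1"
      using cop[of n] by (metis bezout_int coprime_imp_gcd_eq_1)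
    then have "q * u = 1 + (- v) * 2 ^ n" by (simp add: algebra_simps)
    then show "\<exists>i. (q * i) mod 2 ^ n = 1 mod 2 ^ n" by (metis mod_mult_self1)
  qed
  then obtain i where i: "\<And>n. (q * i n) mod 2 ^ n = 1 mod 2 ^ n" by blast
  have coh: "i (Suc n) mod 2 ^ n mod 2 ^ n = i n mod 2 ^ n" for n
  proof -
    have "(q * i (Suc n)) mod 2 ^ n = (q * i n) mod 2 ^ n"
      by (metis i mod_power2_Suc)
    then have "2 ^ n dvd q * (i (Suc n) - i n)"
      by (simp add: mod_eq_dvd_iff right_diff_distrib)
    then have "2 ^ n dvd i (Suc n) - i n"
      using cop by (metis coprime_commute coprime_dvd_mult_right_iff)
    then show ?thesis by (simp add: mod_eq_dvd_iff)
  qed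
  define w where "w = Abs_two_adic (\<lambda>n. i n mod 2 ^ n)"
  have w: "residue w n = i n mod 2 ^ n" for n
    unfolding w_def using coh
    by (subst Abs_two_adic_inverse) (auto simp: mod_power2_Suc simp del: power_Suc)
  have inv: "of_int q * w = 1"
    by (rule two_adic_eqI)
       (simp add: times_two_adic.rep_eq residue_of_int w one_two_adic.rep_eq mod_simps i)
  show ?thesis
  proof (rule ex1I)
    show "of_int q * (w * z) = z" using inv by (metis mult.assoc mult_1)
    show "y = w * z" if "of_int q * y = z" for y
      using inv that by (metis mult.assoc mult.commute mult_1)
  qed
qed

lemma two_adic_of_rat_unique:
  assumes "odd (snd (quotient_of r))"
  shows "of_int (snd (quotient_of r)) * y = of_int (fst (quotient_of r))
    \<longleftrightarrow> y = two_adic_of_rat r"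
  using ex1_odd_quotient[OF assms] unfolding two_adic_of_rat_def
  by (metis (mono_tags, lifting) theI')


section \<open>The \<open>3x + 1\<close> map, parity sequences and the map \<open>Q\<close>\<close>

definition two_adic_half :: "two_adic \<Rightarrow> two_adic" where
  "two_adic_half x = (THE y. 2 * y = x)"

text \<open>The class-based predicates \<open>even\<close> and \<open>odd\<close> are not available on \<open>two_adic\<close>, so parity
  is expressed as divisibility by \<open>2\<close>.\<close>

definition collatz :: "two_adic \<Rightarrow> two_adic" where
  "collatz x = (if 2 dvd x then two_adic_half x else two_adic_half (3 * x + 1))"

definition parity_seq :: "two_adic \<Rightarrow> nat \<Rightarrow> nat" where
  "parity_seq x k = (if 2 dvd (collatz ^^ k) x then 0 else 1)"

definition Q :: "two_adic \<Rightarrow> two_adic" where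
  "Q x = (\<Sum>k. of_nat (parity_seq x k) * 2 ^ k)"

lemma two_mult_left_cancel:
  assumes "2 * y = 2 * (z :: two_adic)"
  shows "y = z"
proof (rule two_adic_eqI)
  fix n
  have "(2 * residue y (Suc n)) mod 2 ^ Suc n = (2 * residue z (Suc n)) mod 2 ^ Suc n"
    using arg_cong[OF assms, of "\<lambda>x. residue x (Suc n)"]
    by (simp add: times_two_adic.rep_eq residue_numeral mod_simps del: power_Suc)
  then have "residue y (Suc n) mod 2 ^ n = residue z (Suc n) mod 2 ^ n"
    by (simp add: mult_mod_right[symmetric])
  then show "residue y n = residue z n" by (simp add: residue_Suc_mod)
qed

lemma two_mult_two_adic_half:
  assumes "2 dvd x"
  shows "2 * two_adic_half x = x"
proof -
  obtain y where "x = 2 * y" using assms by blast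
  then show ?thesis
    unfolding two_adic_half_def by (metis (mono_tags, lifting) theI two_mult_left_cancel)
qed

lemma two_dvd_iff: "2 dvd x \<longleftrightarrow> residue x 1 = 0"
proof
  assume "2 dvd x"
  then show "residue x 1 = 0"
    by (auto simp: times_two_adic.rep_eq residue_numeral elim!: dvdE)
next
  assume x: "residue x 1 = 0"
  define y where "y = Abs_two_adic (\<lambda>n. residue x (Suc n) div 2)"
  have even: "2 * (residue x (Suc n) div 2) = residue x (Suc n)" for n
    using residue_mod_le[of 1 "Suc n" x] x by (simp add: even_iff_mod_2_eq_zero)
  have "(residue x (Suc (Suc n)) div 2) mod 2 ^ n = residue x (Suc n) div 2" for n
  proof -
    have "2 * ((residue x (Suc (Suc n)) div 2) mod 2 ^ n) = residue x (Suc (Suc n)) mod 2 ^ Suc n"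
      by (metis even mult_mod_right power_Suc)
    then show ?thesis using even[of n] residue_Suc_mod[of x "Suc n"] by simp
  qed
  then have y: "residue y n = residue x (Suc n) div 2" for n
    unfolding y_def by (subst Abs_two_adic_inverse) auto
  have "x = 2 * y"
    by (rule two_adic_eqI)
       (simp add: times_two_adic.rep_eq residue_numeral y even mod_simps residue_Suc_mod)
  then show "2 dvd x" by simp
qed

lemma two_dvd_three_mult_plus_one:
  assumes "\<not> 2 dvd x"
  shows "2 dvd 3 * x + (1 :: two_adic)"
proof -
  have "residue x 1 mod 2 = 1"
    using assms residue_mod_self[of x 1] by (auto simp: two_dvd_iff)
  then have "(3 * residue x 1 + 1) mod 2 = 0" by presburger
  then show ?thesis
    by (simp add: two_dvd_iff plus_two_adic.rep_eq times_two_adic.rep_eq residue_numeral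
        one_two_adic.rep_eq mod_simps)
qed

lemma parity_seq_sums_Q: "(\<lambda>k. of_nat (parity_seq x k) * 2 ^ k) sums Q x"
proof -
  define p where "p n = (\<Sum>k<n. int (parity_seq x k) * 2 ^ k)" for n
  define L where "L = Abs_two_adic (\<lambda>n. p n mod 2 ^ n)"
  have "p (Suc n) mod 2 ^ n = p n mod 2 ^ n" for n
    by (simp add: p_def)
  then have L: "residue L n = p n mod 2 ^ n" for n
    unfolding L_def by (subst Abs_two_adic_inverse) (auto simp: mod_power2_Suc simp del: power_Suc)
  have partial: "(\<Sum>k<n. of_nat (parity_seq x k) * 2 ^ k) = (of_int (p n) :: two_adic)" for n
    by (simp add: p_def)
  have bound: "dist (of_int (p n)) L \<le> (1 / 2) ^ n" for n
    by (simp add: dist_two_adic_le_iff residue_of_int L)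
  have "(\<lambda>n. (1 / 2 :: real) ^ n) \<longlonglongrightarrow> 0"
    by (rule LIMSEQ_realpow_zero) auto
  then have "(\<lambda>n. dist (of_int (p n)) L) \<longlonglongrightarrow> 0"
    by (rule tendsto_sandwich[OF _ _ tendsto_const, rotated 2]) (use bound in \<open>auto simp del: power_one_over simp: always_eventually\<close>)
  then have "(\<lambda>k. of_nat (parity_seq x k) * 2 ^ k) sums L"
    unfolding sums_def partial by (subst tendsto_dist_iff)
  then show ?thesis by (simp add: Q_def sums_iff)
qed

end

theory Submission
  imports Defs
begin

text \<open>The map \<open>Q\<close> satisfies \<open>Q x = s\<^sub>0 + 2 * Q (T x)\<close>, so along an eventually periodic orbit of
  \<open>T\<close> it is determined by a linear equation. The orbits are
  \<open>-1/5 \<rightarrow> 1/5 \<rightarrow> 4/5 \<rightarrow> 2/5 \<rightarrow> 1/5\<close> and \<open>5/7 \<rightarrow> 11/7 \<rightarrow> 20/7 \<rightarrow> 10/7 \<rightarrow> 5/7\<close>.\<close>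

lemma two_dvd_of_int_iff: "2 dvd (of_int p :: two_adic) \<longleftrightarrow> even p"
  by (simp add: two_dvd_iff residue_of_int even_iff_mod_2_eq_zero)

text \<open>Divisibility by 2 would pass from \<open>x\<close> to its multiple
  \<open>of_int p\<close>. This reads the oddness of a fraction off its numerator.\<close>

lemma not_two_dvd_if_mult_eq_odd:
  assumes "of_int q * x = (of_int p :: two_adic)" "odd p"
  shows "\<not> 2 dvd x"
proof
  assume "2 dvd x"
  then have "2 dvd of_int q * x" by (rule dvd_mult)
  with assms show False by (simp add: two_dvd_of_int_iff)
qed

text \<open>\<open>two_adic_of_rat\<close> refers to the reduced fraction p'/q'. Since q' divides
  \<open>q\<close>, it is odd as well, and its defining equation times the cofactor \<open>k\<close>
  is the claim.\<close>

lemma two_adic_of_rat_of_int_divide: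
  assumes "odd q"
  shows "of_int q * two_adic_of_rat (of_int p / of_int q) = of_int p"
proof -
  define r :: rat where "r = of_int p / of_int q"
  obtain p' q' where pq: "quotient_of r = (p', q')"
    by (cases "quotient_of r")
  have "q' > 0" "coprime p' q'" "r = of_int p' / of_int q'"
    using pq by (auto intro: quotient_of_denom_pos quotient_of_coprime quotient_of_div)
  moreover have "q \<noteq> 0"
    using assms by auto
  ultimately have "of_int (p' * q) = (of_int (p * q') :: rat)"
    unfolding r_def by (simp add: field_simps)
  then have cross: "p' * q = p * q'"
    by (simp only: of_int_eq_iff)
  then have "q' dvd p' * q" by simp
  with \<open>coprime p' q'\<close> have "q' dvd q"
    by (simp add: coprime_dvd_mult_right_iff coprime_commute)
  then obtain k where k: "q = q' * k" ..
  with cross \<open>q' > 0\<close> have "p = p' * k" by auto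
  have "of_int q' * two_adic_of_rat r = of_int p'"
    using two_adic_of_rat_unique[of r "two_adic_of_rat r"] assms k pq by auto
  then have "of_int k * (of_int q' * two_adic_of_rat r) = of_int k * of_int p'" by simp
  then show ?thesis
    unfolding r_def[symmetric] by (simp add: k \<open>p = p' * k\<close> mult_ac)
qed

lemma odd_mult_left_cancel:
  fixes x y :: two_adic
  assumes "odd q" "of_int q * x = of_int q * y"
  shows "x = y"
proof -
  obtain z where "\<And>w. of_int q * w = of_int q * y \<Longrightarrow> w = z"
    using ex1_odd_quotient[OF assms(1), of "of_int q * y"] by auto
  from this[OF assms(2)] this[OF refl] show ?thesis by simp
qed

lemma two_adic_half_double [simp]: "two_adic_half (2 * y) = y"
  by (rule two_mult_left_cancel) (simp add: two_mult_two_adic_half)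

lemma collatz_double [simp]: "collatz (2 * y) = y"
  by (simp add: collatz_def)

lemma collatz_odd_eqI:
  assumes "\<not> 2 dvd x" "2 * y = 3 * x + 1"
  shows "collatz x = y"
  using assms by (simp add: collatz_def flip: assms(2))

text \<open>Turns the infinite series into finite sums: some partial sum with at least n terms lies
  within (1/2)^n of \<open>Q x\<close>, hence agrees with it modulo 2^n, and its terms from index n
  on vanish modulo 2^n.\<close>

lemma residue_Q: "residue (Q x) n = (\<Sum>k<n. int (parity_seq x k) * 2 ^ k) mod 2 ^ n"
proof -
  define p where "p n = (\<Sum>k<n. int (parity_seq x k) * 2 ^ k)" for n
  have "(\<lambda>m. of_int (p m)) \<longlonglongrightarrow> Q x"
    using parity_seq_sums_Q[of x] by (simp add: sums_def p_def)
  then have "eventually (\<lambda>m. dist (of_int (p m)) (Q x) < (1 / 2) ^ n) sequentially"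
    by (rule tendstoD) simp
  then have "eventually (\<lambda>m. m \<ge> n \<and> dist (of_int (p m)) (Q x) < (1 / 2) ^ n) sequentially"
    using eventually_ge_at_top by (rule eventually_conj[rotated])
  then obtain m where m: "m \<ge> n" "dist (of_int (p m)) (Q x) < (1 / 2) ^ n"
    using eventually_happens'[OF sequentially_bot] by blast
  then have "residue (Q x) n = p m mod 2 ^ n"
    using dist_two_adic_le_iff[of "of_int (p m)" "Q x" n] by (simp add: residue_of_int)
  also have "p m mod 2 ^ n = p n mod 2 ^ n"
    using m(1)
  proof (induction m rule: dec_induct)
    case (step m)
    have "(2 :: int) ^ n dvd p (Suc m) - p m"
      using step.hyps by (simp add: p_def le_imp_power_dvd)
    with step.IH show ?case
      by (metis mod_eq_dvd_iff)
  qed simp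
  finally show ?thesis by (simp add: p_def)
qed

lemma parity_seq_Suc: "parity_seq x (Suc k) = parity_seq (collatz x) k"
  by (simp add: parity_seq_def funpow_swap1)

lemma Q_step: "Q x = of_nat (parity_seq x 0) + 2 * Q (collatz x)"
proof (rule two_adic_eqI)
  fix n
  let ?s = "\<lambda>n. \<Sum>k<n. int (parity_seq (collatz x) k) * 2 ^ k"
  \<comment> \<open>One extra digit is taken so that exactly n terms for \<open>collatz x\<close>
    remain after the first is split off.\<close>
  have "residue (Q x) n = residue (Q x) (Suc n) mod 2 ^ n"
    by (simp add: residue_Suc_mod)
  also have "\<dots> = (\<Sum>k<Suc n. int (parity_seq x k) * 2 ^ k) mod 2 ^ n"
    by (simp only: residue_Q mod_power2_Suc)
  also have "\<dots> = (int (parity_seq x 0) + 2 * ?s n) mod 2 ^ n"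
    by (simp only: sum.lessThan_Suc_shift parity_seq_Suc sum_distrib_left) (simp add: mult_ac)
  also have "\<dots> = residue (of_nat (parity_seq x 0) + 2 * Q (collatz x)) n"
    by (simp add: plus_two_adic.rep_eq times_two_adic.rep_eq residue_of_nat residue_numeral
        residue_Q mod_simps)
  finally show "residue (Q x) n = residue (of_nat (parity_seq x 0) + 2 * Q (collatz x)) n" .
qed

lemma Q_double: "Q (2 * y) = 2 * Q y"
  using Q_step[of "2 * y"] by (simp add: parity_seq_def)

lemma Q_odd:
  assumes "\<not> 2 dvd x" "2 * y = 3 * x + 1"
  shows "Q x = 1 + 2 * Q y"
  using Q_step[of x] assms by (simp add: parity_seq_def collatz_odd_eqI)

text \<open>Covers in one go the two even steps that close each loop, from 4/5 to 1/5 and from 20/7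
  to 5/7.\<close>

lemma Q_four_mult: "Q (4 * y) = 4 * Q y"
  using Q_double[of "2 * y"] Q_double[of y] by (simp flip: mult.assoc)

text \<open>The loop through \<open>- a\<close> = 1/5 gives Q(1/5) = 1 + 8 Q(1/5), so Q(1/5) = -1/7
  and Q(-1/5) = 1 - 2/7.\<close>

lemma Q_minus_one_fifth:
  assumes a: "5 * a = - 1"
  shows "7 * Q a = 5"
proof -
  have odd: "\<not> 2 dvd a" "\<not> 2 dvd - a"
    using not_two_dvd_if_mult_eq_odd[of 5 a "- 1"] a by auto
  \<comment> \<open>Both right-hand sides vanish by assumption, so T maps \<open>a\<close> to
    \<open>- a\<close> and \<open>- a\<close> to \<open>4 * - a\<close>.\<close>
  have "2 * - a - (3 * a + 1) = - (5 * a + 1)" "2 * (4 * - a) - (3 * - a + 1) = - (5 * a + 1)"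
    by (simp_all add: algebra_simps)
  with a have "2 * - a = 3 * a + 1" "2 * (4 * - a) = 3 * - a + 1"
    by simp_all
  then have Q: "Q a = 1 + 2 * Q (- a)" "Q (- a) = 1 + 2 * (4 * Q (- a))"
    by (metis Q_odd odd Q_four_mult)+
  have "7 * Q (- a) = (1 + 2 * (4 * Q (- a))) - Q (- a) - 1"
    by (simp add: algebra_simps)
  also have "\<dots> = - 1"
    by (simp only: Q(2)[symmetric]) simp
  finally have "7 * Q (- a) = - 1" .
  moreover have "7 * Q a = 7 + 2 * (7 * Q (- a))"
    by (simp add: Q(1) algebra_simps)
  ultimately show ?thesis by simp
qed

text \<open>Going once around the loop gives Q(5/7) = 3 + 16 Q(5/7), that is 15 Q(5/7) = -3; the odd
  factor 3 is then cancelled.\<close>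

lemma Q_five_sevenths:
  assumes c: "7 * c = 5"
  shows "5 * Q c = - 1"
proof -
  \<comment> \<open>\<open>d\<close> is 11/7, written as 25/7 - 2 so that the equations about it
    become ring identities modulo \<open>7 * c - 5\<close>.\<close>
  define d where "d = 5 * c - 2"
  have "7 * d - 11 = 5 * (7 * c - 5)" "2 * d - (3 * c + 1) = 7 * c - 5"
    "2 * (4 * c) - (3 * d + 1) = - (7 * c - 5)"
    by (simp_all add: d_def algebra_simps)
  with c have d: "7 * d = 11" "2 * d = 3 * c + 1" "2 * (4 * c) = 3 * d + 1"
    by simp_all
  have odd: "\<not> 2 dvd c" "\<not> 2 dvd d"
    using not_two_dvd_if_mult_eq_odd[of 7 c 5] not_two_dvd_if_mult_eq_odd[of 7 d 11] c d(1) by auto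
  have Q: "Q c = 1 + 2 * (1 + 2 * (4 * Q c))"
    by (metis Q_odd odd d(2,3) Q_four_mult)
  have "3 * (5 * Q c) = (1 + 2 * (1 + 2 * (4 * Q c))) - Q c - 3"
    by (simp add: algebra_simps)
  also have "\<dots> = 3 * - 1"
    by (simp only: Q[symmetric]) simp
  finally show ?thesis
    using odd_mult_left_cancel[of 3 "5 * Q c" "- 1"] by simp
qed

theorem mainTheorem4:
  shows "Q (two_adic_of_rat (- 1 / 5)) = two_adic_of_rat (5 / 7)
    \<and> Q (two_adic_of_rat (5 / 7)) = two_adic_of_rat (- 1 / 5)
    \<and> two_adic_of_rat (- 1 / 5) \<noteq> two_adic_of_rat (5 / 7)
    \<and> \<not> 2 dvd two_adic_of_rat (- 1 / 5)
    \<and> \<not> 2 dvd two_adic_of_rat (5 / 7)"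
proof -
  define a c where "a = two_adic_of_rat (- 1 / 5)" and "c = two_adic_of_rat (5 / 7)"
  have a: "5 * a = - 1" and c: "7 * c = 5"
    using two_adic_of_rat_of_int_divide[of 5 "- 1"] two_adic_of_rat_of_int_divide[of 7 5]
    by (simp_all add: a_def c_def)
  have "Q a = c"
    by (rule odd_mult_left_cancel[of 7]) (simp_all add: Q_minus_one_fifth[OF a] c)
  moreover have "Q c = a"
    by (rule odd_mult_left_cancel[of 5]) (simp_all add: Q_five_sevenths[OF c] a)
  moreover have "a \<noteq> c"
  proof
    assume "a = c"
    have "- 7 = 7 * (5 * a)" unfolding a by simp
    also have "\<dots> = 5 * (7 * c)" using \<open>a = c\<close> by simp
    also have "\<dots> = 25" unfolding c by simp
    finally have "of_int (- 7) = (of_int 25 :: two_adic)" by simp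
    \<comment> \<open>The difference 25 - (-7) is 2^5, so 2^6 is the first modulus that separates
      the two integers.\<close>
    then have "residue (of_int (- 7)) 6 = residue (of_int 25) 6" by (rule arg_cong)
    then show False by (simp only: residue_of_int) simp
  qed
  moreover have "\<not> 2 dvd a" "\<not> 2 dvd c"
    using not_two_dvd_if_mult_eq_odd[of 5 a "- 1"] not_two_dvd_if_mult_eq_odd[of 7 c 5] a c
    by auto
  ultimately show ?thesis by (simp add: a_def c_def)
qed

end
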